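(* Let $X$ be a finite set of $M$ gridpoints $\mathbf{x}_{i,j}=(x_i,y_j)$ of a uniform Cartesian grid in $\mathbb{R}^2$ with spacing $h>0$; let $\lambda>0$ and let $q_{i,j}\in\mathbb{R}$, $K_{i,j}\ge0$, $f_{i,j}>0$ be given at every gridpoint. Consider the system of equations for a grid function $V=(V_{i,j})$ $$V_{i,j}=q_{i,j}+\frac1\lambda\left[K_{i,j}-f_{i,j}\sqrt{\left(\max(D^{-x}_{ij}V,\,-D^{+x}_{ij}V,\,0)\right)^2+\left(\max(D^{-y}_{ij}V,\,-D^{+y}_{ij}V,\,0)\right)^2}\;\right]^{-}\qquad\text{for all }\mathbf{x}_{i,j}\in X .\qquad( * )$$ Then the following modified Fast Marching Method, when it terminates, produces a grid function $V$ satisfying $( * )$ at all gridpoints, and (with the $Considered$ list kept in a heap) its computational cost is $O(M\log M)$. Algorithm: Mark all gridpoints $Far$ and set $V(\mathbf{x}):=q(\mathbf{x})$ for all $\mathbf{x}\in X$. Mark as $Considered$ all local minima of $q$ on the grid (gridpoints whose value of $q$ is not larger than that of any of their grid neighbors). While there are $Considered$ gridpoints: let $\bar{\mathbf{x}}$ be a $Considered$ gridpoint with the smallest value $V(\bar{\mathbf{x}})$ and mark it $Accepted$ (it is then no longer $Considered$); for each not-yet-$Accepted$ neighbor $\mathbf{x}_{i,j}$ of $\bar{\mathbf{x}}$, update $V_{i,j}$ by solving equation $( * )$ at $\mathbf{x}_{i,j}$ for $V_{i,j}$ using the current values at its neighbors, and, if $\mathbf{x}_{i,j}$ is $Far$,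 mark it $Considered$.
   Context: $[z]^-=\min(z,0)$. The one-sided differences are $D^{\pm x}_{ij}V=\frac{V_{i\pm1,j}-V_{i,j}}{\pm h}$ and $D^{\pm y}_{ij}V=\frac{V_{i,j\pm1}-V_{i,j}}{\pm h}$. The neighbors of $\mathbf{x}_{i,j}$ are those of $\mathbf{x}_{i+1,j},\mathbf{x}_{i-1,j},\mathbf{x}_{i,j+1},\mathbf{x}_{i,j-1}$ that belong to $X$; a one-sided difference involving a point outside $X$ is omitted from the maximum (equivalently, the missing value is $+\infty$). The system $( * )$ is an upwind discretization of the variational inequality $v=q+\frac1\lambda[K-f|\nabla v|]^-$ for the value function of an isotropic randomly-terminated optimal control problem. *)

theory Defs
  imports Complex_Main "HOL-Library.Landau_Symbols" "HOL-Library.While_Combinator"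
begin

section \<open>The discretized problem\<close>

text \<open>The gridpoint \<open>x_ij = (x_0 + i h, y_0 + j h)\<close> is represented by its index pair \<open>(i, j)\<close>.
  The functions \<open>qfun\<close>, \<open>Kfun\<close>, \<open>ffun\<close> and all grid functions are total; their values
  outside \<open>gridpts\<close> are never used.\<close>

type_synonym gridpoint = "int \<times> int"

record upwind_problem =
  gridpts :: "gridpoint set"
  spacing :: real
  rate :: real  \<comment> \<open>\<open>\<lambda>\<close>\<close>
  qfun :: "gridpoint \<Rightarrow> real"
  Kfun :: "gridpoint \<Rightarrow> real"
  ffun :: "gridpoint \<Rightarrow> real"

definition valid_problem :: "upwind_problem \<Rightarrow> bool" where
  "valid_problem P \<longleftrightarrow> finite (gridpts P) \<and> spacing P > 0 \<and> rate P > 0 \<and>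
     (\<forall>x\<in>gridpts P. Kfun P x \<ge> 0 \<and> ffun P x > 0)"

definition neg_part :: "real \<Rightarrow> real" where
  "neg_part z = min z 0"

definition D_plus_x :: "real \<Rightarrow> (gridpoint \<Rightarrow> real) \<Rightarrow> int \<Rightarrow> int \<Rightarrow> real" where
  "D_plus_x h V i j = (V (i + 1, j) - V (i, j)) / h"

definition D_minus_x :: "real \<Rightarrow> (gridpoint \<Rightarrow> real) \<Rightarrow> int \<Rightarrow> int \<Rightarrow> real" where
  "D_minus_x h V i j = (V (i - 1, j) - V (i, j)) / (- h)"

definition D_plus_y :: "real \<Rightarrow> (gridpoint \<Rightarrow> real) \<Rightarrow> int \<Rightarrow> int \<Rightarrow> real" where
  "D_plus_y h V i j = (V (i, j + 1) - V (i, j)) / h"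

definition D_minus_y :: "real \<Rightarrow> (gridpoint \<Rightarrow> real) \<Rightarrow> int \<Rightarrow> int \<Rightarrow> real" where
  "D_minus_y h V i j = (V (i, j - 1) - V (i, j)) / (- h)"

definition upwind_x :: "upwind_problem \<Rightarrow> (gridpoint \<Rightarrow> real) \<Rightarrow> int \<Rightarrow> int \<Rightarrow> real" where
  "upwind_x P V i j = Max (
     (if (i - 1, j) \<in> gridpts P then {D_minus_x (spacing P) V i j} else {}) \<union>
     (if (i + 1, j) \<in> gridpts P then {- D_plus_x (spacing P) V i j} else {}) \<union> {0})"

definition upwind_y :: "upwind_problem \<Rightarrow> (gridpoint \<Rightarrow> real) \<Rightarrow> int \<Rightarrow> int \<Rightarrow> real" where
  "upwind_y P V i j = Max (
     (if (i, j - 1) \<in> gridpts P then {D_minus_y (spacing P) V i j} else {}) \<union>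
     (if (i, j + 1) \<in> gridpts P then {- D_plus_y (spacing P) V i j} else {}) \<union> {0})"

fun upwind_eq :: "upwind_problem \<Rightarrow> (gridpoint \<Rightarrow> real) \<Rightarrow> gridpoint \<Rightarrow> bool" where
  "upwind_eq P V (i, j) \<longleftrightarrow>
     V (i, j) = qfun P (i, j) + 1 / rate P *
       neg_part (Kfun P (i, j) - ffun P (i, j) * sqrt ((upwind_x P V i j)\<^sup>2 + (upwind_y P V i j)\<^sup>2))"

fun nbr_list :: "upwind_problem \<Rightarrow> gridpoint \<Rightarrow> gridpoint list" where
  "nbr_list P (i, j) =
     filter (\<lambda>y. y \<in> gridpts P) [(i + 1, j), (i - 1, j), (i, j + 1), (i, j - 1)]"

abbreviation nbrs :: "upwind_problem \<Rightarrow> gridpoint \<Rightarrow> gridpoint set" where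
  "nbrs P x \<equiv> set (nbr_list P x)"

definition local_min :: "upwind_problem \<Rightarrow> gridpoint \<Rightarrow> bool" where
  "local_min P x \<longleftrightarrow> x \<in> gridpts P \<and> (\<forall>y\<in>nbrs P x. qfun P x \<le> qfun P y)"


section \<open>The modified Fast Marching Method\<close>

text \<open>The method is a transition system on pairs (current values, labels). It is nondeterministic
  in the choice among several minimal Considered points and in the order in which the neighbors of
  the newly accepted point are processed.\<close>

datatype label = Far | Considered | Accepted

type_synonym fmm_state = "(gridpoint \<Rightarrow> real) \<times> (gridpoint \<Rightarrow> label)"

definition fmm_init :: "upwind_problem \<Rightarrow> fmm_state" where
  "fmm_init P = (qfun P, \<lambda>x. if local_min P x then Considered else Far)"

inductive fmm_updates :: "upwind_problem \<Rightarrow> gridpoint list \<Rightarrow> fmm_state \<Rightarrow> fmm_state \<Rightarrow> bool"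
  for P where
  Nil: "fmm_updates P [] s s"
| Cons: "\<lbrakk>upwind_eq P (V(y := u)) y;
          fmm_updates P ys (V(y := u), if L y = Far then L(y := Considered) else L) s'\<rbrakk>
         \<Longrightarrow> fmm_updates P (y # ys) (V, L) s'"

inductive fmm_step :: "upwind_problem \<Rightarrow> fmm_state \<Rightarrow> fmm_state \<Rightarrow> bool"
  for P where
  "\<lbrakk>x \<in> gridpts P; L x = Considered;
    \<forall>y\<in>gridpts P. L y = Considered \<longrightarrow> V x \<le> V y;
    L' = L(x := Accepted);
    distinct ys; set ys = {y \<in> nbrs P x. L' y \<noteq> Accepted};
    fmm_updates P ys (V, L') s'\<rbrakk>
   \<Longrightarrow> fmm_step P (V, L) s'"

definition fmm_output :: "upwind_problem \<Rightarrow> (gridpoint \<Rightarrow> real) \<Rightarrow> bool" where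
  "fmm_output P V \<longleftrightarrow>
     (\<exists>L. (fmm_step P)\<^sup>*\<^sup>* (fmm_init P) (V, L) \<and> (\<forall>x\<in>gridpts P. L x \<noteq> Considered))"


section \<open>Binary heaps\<close>

text \<open>A heap is a triple (array, back pointers, size): the array holds gridpoints at the indices
  \<open>1, \<dots>, size\<close>, the children of index \<open>i\<close> are \<open>2 i\<close> and \<open>2 i + 1\<close>, and the
  back pointers give the index of each stored gridpoint. The keys are the current values \<open>V\<close>,
  kept outside the heap. An update in the method never raises a value, so the only key change
  needed is a decrease. Every operation returns the new heap together with its cost: one unit per
  level visited, since a bounded number of array accesses and comparisons is made there.\<close>

type_synonym heap = "(nat \<Rightarrow> gridpoint) \<times> (gridpoint \<Rightarrow> nat) \<times> nat"

fun heap_arr :: "heap \<Rightarrow> nat \<Rightarrow> gridpoint" where "heap_arr (A, B, n) = A"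
fun heap_pos :: "heap \<Rightarrow> gridpoint \<Rightarrow> nat" where "heap_pos (A, B, n) = B"
fun heap_size :: "heap \<Rightarrow> nat" where "heap_size (A, B, n) = n"

fun heap_swap :: "nat \<Rightarrow> nat \<Rightarrow> heap \<Rightarrow> heap" where
  "heap_swap i j (A, B, n) = (A(i := A j, j := A i), B(A j := i, A i := j), n)"

function sift_up :: "(gridpoint \<Rightarrow> real) \<Rightarrow> nat \<Rightarrow> heap \<Rightarrow> heap \<times> nat" where
  "sift_up V i H =
     (if i \<le> 1 \<or> V (heap_arr H (i div 2)) \<le> V (heap_arr H i) then (H, 1)
      else let (H', c) = sift_up V (i div 2) (heap_swap i (i div 2) H) in (H', c + 1))"
  by pat_completeness auto
termination by (relation "measure (\<lambda>(V, i, H). i)") auto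

definition min_child :: "(gridpoint \<Rightarrow> real) \<Rightarrow> nat \<Rightarrow> heap \<Rightarrow> nat" where
  "min_child V i H =
     (if 2 * i + 1 \<le> heap_size H \<and> V (heap_arr H (2 * i + 1)) < V (heap_arr H (2 * i))
      then 2 * i + 1 else 2 * i)"

lemma heap_size_swap [simp]: "heap_size (heap_swap i j H) = heap_size H"
  by (cases H) simp

function sift_down :: "(gridpoint \<Rightarrow> real) \<Rightarrow> nat \<Rightarrow> heap \<Rightarrow> heap \<times> nat" where
  "sift_down V i H =
     (if i = 0 \<or> heap_size H < 2 * i \<or> V (heap_arr H i) \<le> V (heap_arr H (min_child V i H))
      then (H, 1)
      else let (H', c) = sift_down V (min_child V i H) (heap_swap i (min_child V i H) H)
           in (H', c + 1))"
  by pat_completeness auto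
termination
  by (relation "measure (\<lambda>(V, i, H). heap_size H - i)") (auto simp: min_child_def)

declare sift_up.simps [simp del] sift_down.simps [simp del]

fun heap_insert :: "(gridpoint \<Rightarrow> real) \<Rightarrow> gridpoint \<Rightarrow> heap \<Rightarrow> heap \<times> nat" where
  "heap_insert V x (A, B, n) = sift_up V (n + 1) (A(n + 1 := x), B(x := n + 1), n + 1)"

definition heap_decrease_key :: "(gridpoint \<Rightarrow> real) \<Rightarrow> gridpoint \<Rightarrow> heap \<Rightarrow> heap \<times> nat" where
  "heap_decrease_key V x H = sift_up V (heap_pos H x) H"

fun shrink :: "heap \<Rightarrow> heap" where
  "shrink (A, B, n) = (A, B, n - 1)"

definition heap_delete_min :: "(gridpoint \<Rightarrow> real) \<Rightarrow> heap \<Rightarrow> heap \<times> nat" where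
  "heap_delete_min V H = sift_down V 1 (shrink (heap_swap 1 (heap_size H) H))"


section \<open>The method with the Considered list kept in a heap\<close>

text \<open>The last component of the state is the accumulated cost in the unit-cost real RAM model:
  arithmetic, comparisons and array accesses on reals, indices and labels each take constant time,
  and so does the solution of the upwind equation for one unknown value, which involves
  at most four neighbor values and at most quadratic equations. One unit is charged for each bounded group of such operations: in
  \<open>heap_update\<close> for the local solve and the label, in \<open>heap_fmm_step\<close> for the loop test, the label
  and the scan of the at most four neighbors.\<close>

type_synonym heap_fmm_state =
  "(gridpoint \<Rightarrow> real) \<times> (gridpoint \<Rightarrow> label) \<times> heap \<times> nat"

definition local_solve :: "upwind_problem \<Rightarrow> (gridpoint \<Rightarrow> real) \<Rightarrow> gridpoint \<Rightarrow> real" where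
  "local_solve P V y = (THE u. upwind_eq P (V(y := u)) y)"

text \<open>Initialization: one unit per gridpoint for its value and label, and one for
  comparing its \<open>q\<close> with its at most four neighbors.\<close>

fun heap_mark :: "upwind_problem \<Rightarrow> gridpoint \<Rightarrow> heap_fmm_state \<Rightarrow> heap_fmm_state" where
  "heap_mark P x (V, L, H, c) =
     (if local_min P x
      then let (H', c') = heap_insert V x H in (V, L(x := Considered), H', c + 1 + c')
      else (V, L, H, c + 1))"

definition heap_fmm_init :: "upwind_problem \<Rightarrow> gridpoint list \<Rightarrow> heap_fmm_state" where
  "heap_fmm_init P xs =
     fold (heap_mark P) xs (qfun P, \<lambda>_. Far, (\<lambda>_. undefined, \<lambda>_. undefined, 0), length xs)"

fun heap_update :: "upwind_problem \<Rightarrow> gridpoint \<Rightarrow> heap_fmm_state \<Rightarrow> heap_fmm_state" where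
  "heap_update P y (V, L, H, c) =
     (let V' = V(y := local_solve P V y)
      in if L y = Far
         then let (H', c') = heap_insert V' y H in (V', L(y := Considered), H', c + 1 + c')
         else let (H', c') = heap_decrease_key V' y H in (V', L, H', c + 1 + c'))"

fun heap_fmm_step :: "upwind_problem \<Rightarrow> heap_fmm_state \<Rightarrow> heap_fmm_state" where
  "heap_fmm_step P (V, L, H, c) =
     (let x = heap_arr H 1;
          (H', c') = heap_delete_min V H;
          L' = L(x := Accepted)
      in fold (heap_update P) (filter (\<lambda>y. L' y \<noteq> Accepted) (nbr_list P x))
           (V, L', H', c + 1 + c'))"

text \<open>The list \<open>xs\<close> enumerates the gridpoints. The result is \<open>None\<close> iff the loop
  does not terminate.\<close>

definition heap_fmm :: "upwind_problem \<Rightarrow> gridpoint list \<Rightarrow> heap_fmm_state option" where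
  "heap_fmm P xs =
     while_option (\<lambda>(V, L, H, c). heap_size H \<noteq> 0) (heap_fmm_step P) (heap_fmm_init P xs)"

end

theory Submission
  imports Defs "HOL-Real_Asymp.Real_Asymp"
begin

text \<open>Only neighbors with a smaller value enter the upwind equation at a point, so its residual is
  strictly increasing in the unknown value and antitone in the neighbor values. Hence values only
  decrease during the method and are always supersolutions. The method accepts values in
  nondecreasing order: a Far point always lies above some Considered point, because its descending
  path in \<open>q\<close> has to cross the Considered list, and an update made when the value \<open>v\<close>
  is accepted cannot fall below \<open>v\<close>, as it would then depend on earlier accepted points
  only, to which the previous value was already adapted. So every value stays a subsolution
  when only accepted neighbors are counted, and at the end all points are accepted. For the cost, each
  step accepts one point and performs at most five heap operations.\<close>

section \<open>The upwind residual\<close>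

text \<open>Taking the maximum with 0 separately for each neighbor allows neighbors to be compared
  one at a time. A neighbor that is missing or not counted contributes 0, as one with value
  +infinity would.\<close>

definition drop_to :: "upwind_problem \<Rightarrow> gridpoint set \<Rightarrow> (gridpoint \<Rightarrow> real) \<Rightarrow> real \<Rightarrow> gridpoint \<Rightarrow> real" where
  "drop_to P A V u n = (if n \<in> A \<inter> gridpts P then max 0 ((u - V n) / spacing P) else 0)"

fun slope :: "upwind_problem \<Rightarrow> gridpoint set \<Rightarrow> (gridpoint \<Rightarrow> real) \<Rightarrow> real \<Rightarrow> gridpoint \<Rightarrow> real" where
  "slope P A V u (i, j) = sqrt (
     (max (drop_to P A V u (i - 1, j)) (drop_to P A V u (i + 1, j)))\<^sup>2 +
     (max (drop_to P A V u (i, j - 1)) (drop_to P A V u (i, j + 1)))\<^sup>2)"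

text \<open>Only neighbors in \<open>A\<close> are taken into account, the values at the others
  being regarded as \<open>+\<infinity>\<close>; \<open>A = UNIV\<close> gives the residual of the upwind equation itself.\<close>

definition residual :: "upwind_problem \<Rightarrow> gridpoint set \<Rightarrow> (gridpoint \<Rightarrow> real) \<Rightarrow> real \<Rightarrow> gridpoint \<Rightarrow> real" where
  "residual P A V u x =
     u - qfun P x - 1 / rate P * neg_part (Kfun P x - ffun P x * slope P A V u x)"

section \<open>Grid neighborhoods\<close>

lemma nbrs_iff:
  "y \<in> nbrs P (i, j) \<longleftrightarrow>
     y \<in> gridpts P \<and> y \<in> {(i + 1, j), (i - 1, j), (i, j + 1), (i, j - 1)}"
  unfolding nbr_list.simps set_filter by auto

lemma distinct_nbr_list: "distinct (nbr_list P x)"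
  by (cases x) (simp only: nbr_list.simps distinct_filter, simp)

lemma length_nbr_list: "length (nbr_list P x) \<le> 4"
proof (cases x)
  case (Pair i j)
  show ?thesis
    unfolding Pair nbr_list.simps by (rule order_trans[OF length_filter_le]) simp
qed

declare nbr_list.simps [simp del]

lemma nbrs_in_gridpts: "y \<in> nbrs P x \<Longrightarrow> y \<in> gridpts P"
  by (cases x) (simp add: nbrs_iff)

lemma nbrs_sym: "x \<in> gridpts P \<Longrightarrow> y \<in> nbrs P x \<Longrightarrow> x \<in> nbrs P y"
  by (cases x; cases y) (auto simp: nbrs_iff)

lemma nbrs_irrefl: "x \<notin> nbrs P x"
  by (cases x) (simp add: nbrs_iff)

section \<open>Monotonicity of the residual\<close>

lemma drop_to_nonneg: "0 \<le> drop_to P A V u n"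
  by (simp add: drop_to_def)

lemma slope_mono:
  assumes "\<And>n. n \<in> nbrs P x \<Longrightarrow> drop_to P A V u n \<le> drop_to P A' V' u' n"
  shows "slope P A V u x \<le> slope P A' V' u' x"
proof (cases x)
  case (Pair i j)
  have le: "drop_to P A V u n \<le> drop_to P A' V' u' n"
    if "n \<in> {(i - 1, j), (i + 1, j), (i, j - 1), (i, j + 1)}" for n
  proof (cases "n \<in> gridpts P")
    case True
    then show ?thesis using that by (intro assms) (auto simp: Pair nbrs_iff)
  next
    case False
    then show ?thesis by (simp add: drop_to_def)
  qed
  show ?thesis unfolding Pair slope.simps
    by (intro real_sqrt_le_mono add_mono power_mono max.mono le)
      (auto simp: le_max_iff_disj drop_to_nonneg)
qed

text \<open>Subtracting the unknown leaves the slope term, which grows with each difference between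
  the unknown and a counted lower neighbor; neighbors at or above the unknown add nothing. Changes
  of the unknown, of the values and of the counted set are all special cases.\<close>

lemma residual_mono:
  assumes "valid_problem P" "x \<in> gridpts P"
    and "\<And>n. n \<in> nbrs P x \<Longrightarrow> n \<in> A \<Longrightarrow> V n < u \<Longrightarrow> n \<in> A' \<and> u - V n \<le> u' - V' n"
  shows "residual P A V u x - u \<le> residual P A' V' u' x - u'"
proof -
  have h: "spacing P > 0" and r: "rate P > 0" and f: "ffun P x > 0"
    using assms by (auto simp: valid_problem_def)
  have "slope P A V u x \<le> slope P A' V' u' x"
  proof (rule slope_mono)
    fix n assume n: "n \<in> nbrs P x"
    show "drop_to P A V u n \<le> drop_to P A' V' u' n"
    proof (cases "n \<in> A \<and> V n < u")
      case True
      then have "n \<in> A'" "(u - V n) / spacing P \<le> (u' - V' n) / spacing P"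
        using assms(3)[OF n] h by (auto simp: divide_right_mono)
      then show ?thesis by (auto simp: drop_to_def max_def)
    next
      case False
      then have "drop_to P A V u n = 0"
        using h by (auto simp: drop_to_def max_def field_simps)
      then show ?thesis by (simp add: drop_to_nonneg)
    qed
  qed
  then have "ffun P x * slope P A V u x \<le> ffun P x * slope P A' V' u' x"
    using f by (simp add: mult_left_mono)
  then have "neg_part (Kfun P x - ffun P x * slope P A' V' u' x)
      \<le> neg_part (Kfun P x - ffun P x * slope P A V u x)"
    by (auto simp: neg_part_def)
  then have "1 / rate P * neg_part (Kfun P x - ffun P x * slope P A' V' u' x)
      \<le> 1 / rate P * neg_part (Kfun P x - ffun P x * slope P A V u x)"
    using r by (intro mult_left_mono) auto
  then show ?thesis by (simp add: residual_def)
qed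

text \<open>The slope term is only weakly monotone; strictness comes from the summand
  \<open>u\<close>.\<close>

lemma residual_strict_mono:
  assumes "valid_problem P" "x \<in> gridpts P" "u < u'"
  shows "residual P A V u x < residual P A V u' x"
  using residual_mono[OF assms(1,2), of A V u A u' V] assms(3) by auto

text \<open>This is the causality of the scheme: a neighbor at or above \<open>u\<close> has drop 0,
  counted or not. It is what lets accepted points alone determine a value.\<close>

lemma residual_cong:
  assumes "valid_problem P" "x \<in> gridpts P"
    and "\<And>n. n \<in> nbrs P x \<Longrightarrow> V n < u \<Longrightarrow> n \<in> A \<longleftrightarrow> n \<in> A'"
  shows "residual P A V u x = residual P A' V u x"
proof -
  have "residual P A V u x - u \<le> residual P A' V u x - u"
    by (rule residual_mono[OF assms(1,2)]) (use assms(3) in blast)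
  moreover have "residual P A' V u x - u \<le> residual P A V u x - u"
    by (rule residual_mono[OF assms(1,2)]) (use assms(3) in blast)
  ultimately show ?thesis by simp
qed

lemma residual_upd:
  assumes "valid_problem P" "x \<in> gridpts P" "y \<notin> nbrs P x \<inter> A"
  shows "residual P A (V(y := w)) u x = residual P A V u x"
proof -
  have "residual P A (V(y := w)) u x - u \<le> residual P A V u x - u"
    by (rule residual_mono[OF assms(1,2)]) (use assms(3) in \<open>auto split: if_splits\<close>)
  moreover have "residual P A V u x - u \<le> residual P A (V(y := w)) u x - u"
    by (rule residual_mono[OF assms(1,2)]) (use assms(3) in \<open>auto split: if_splits\<close>)
  ultimately show ?thesis by simp
qed

section \<open>The upwind equation as a root-finding problem\<close>

lemma upwind_eq_iff_residual:
  assumes "valid_problem P"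
  shows "upwind_eq P V x \<longleftrightarrow> residual P UNIV V (V x) x = 0"
proof (cases x)
  case (Pair i j)
  \<comment> \<open>Distributing the maximum with 0 over both sides turns the \<open>Max\<close> of
    a set into the form of \<open>drop_to\<close>, an omitted difference becoming 0.\<close>
  have Max_real: "Max ((if p then {a} else {}) \<union> (if p' then {b} else {}) \<union> {0}) =
      max (if p then max 0 a else 0) (if p' then max 0 b else 0)" for p p' and a b :: real
    by (cases p; cases p') (simp_all add: max.assoc max.left_commute max.commute)
  \<comment> \<open>Both sign conventions reduce to the value at the point minus the value at the
    neighbor, divided by the spacing.\<close>
  have minus: "(a - b) / - c = (b - a) / c" "- ((a - b) / c) = (b - a) / c" for a b c :: real
    by (simp_all add: minus_divide_left)
  have "upwind_x P V i j =
      max (drop_to P UNIV V (V x) (i - 1, j)) (drop_to P UNIV V (V x) (i + 1, j))"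
    unfolding upwind_x_def Max_real drop_to_def D_minus_x_def D_plus_x_def minus Pair by simp
  moreover have "upwind_y P V i j =
      max (drop_to P UNIV V (V x) (i, j - 1)) (drop_to P UNIV V (V x) (i, j + 1))"
    unfolding upwind_y_def Max_real drop_to_def D_minus_y_def D_plus_y_def minus Pair by simp
  ultimately show ?thesis by (auto simp: Pair residual_def)
qed

lemma upwind_eq_upd_iff_residual:
  assumes "valid_problem P" "x \<in> gridpts P"
  shows "upwind_eq P (V(x := u)) x \<longleftrightarrow> residual P UNIV V u x = 0"
  using assms by (simp add: upwind_eq_iff_residual residual_upd nbrs_irrefl)

text \<open>Existence is the intermediate value theorem, uniqueness is strict monotonicity. This
  makes the definite description in \<open>local_solve\<close> meaningful.\<close>

lemma upwind_eq_solvable: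
  assumes "valid_problem P" "x \<in> gridpts P"
  shows "\<exists>!u. upwind_eq P (V(x := u)) x"
proof -
  \<comment> \<open>No neighbor lies below \<open>m\<close>, so the slope vanishes there and, as
    \<open>Kfun P x \<ge> 0\<close>, the residual is \<open>m - qfun P x \<le> 0\<close>. At
    \<open>qfun P x\<close> only the nonnegative slope term is left.\<close>
  define m where "m = Min (insert (qfun P x) (V ` nbrs P x))"
  have m: "m \<le> qfun P x" "\<And>n. n \<in> nbrs P x \<Longrightarrow> m \<le> V n"
    by (auto simp: m_def)
  have r: "rate P > 0" using assms by (simp add: valid_problem_def)
  have "residual P UNIV V m x = residual P {} V m x"
    by (rule residual_cong[OF assms]) (use leD[OF m(2)] in blast)
  also have "slope P {} V m x = 0"
    by (cases x) (simp add: drop_to_def)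
  then have "residual P {} V m x = m - qfun P x"
    using assms by (simp add: residual_def neg_part_def valid_problem_def)
  finally have lo: "residual P UNIV V m x \<le> 0" using m(1) by simp
  have hi: "0 \<le> residual P UNIV V (qfun P x) x"
    using r by (auto simp: residual_def neg_part_def divide_le_0_iff)
  have "continuous_on UNIV (\<lambda>u. drop_to P UNIV V u n)" for n
    using assms by (cases "n \<in> gridpts P")
      (auto simp: drop_to_def valid_problem_def intro!: continuous_intros)
  then have "continuous_on UNIV (\<lambda>u. slope P UNIV V u x)"
    by (cases x) (auto intro!: continuous_intros)
  then have "continuous_on UNIV (\<lambda>u. residual P UNIV V u x)"
    unfolding residual_def neg_part_def by (intro continuous_intros)
  then have "continuous_on {m..qfun P x} (\<lambda>u. residual P UNIV V u x)"
    by (rule continuous_on_subset) simp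
  then obtain u where u: "residual P UNIV V u x = 0"
    using IVT'[of "\<lambda>u. residual P UNIV V u x" m 0 "qfun P x"] lo hi m(1) by auto
  show ?thesis
    unfolding upwind_eq_upd_iff_residual[OF assms]
  proof (rule ex1I[of _ u])
    show "w = u" if "residual P UNIV V w x = 0" for w
      using that u residual_strict_mono[OF assms, of w u UNIV V]
        residual_strict_mono[OF assms, of u w UNIV V] by linarith
  qed (fact u)
qed

lemma upwind_eq_local_solve:
  assumes "valid_problem P" "x \<in> gridpts P"
  shows "upwind_eq P (V(x := local_solve P V x)) x"
  unfolding local_solve_def by (rule theI'[OF upwind_eq_solvable[OF assms]])


section \<open>The Fast Marching invariant\<close>

abbreviation acc :: "(gridpoint \<Rightarrow> label) \<Rightarrow> gridpoint set" where
  "acc L \<equiv> {x. L x = Accepted}"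

text \<open>In the course of a main step, \<open>A\<close> is the set of points accepted before it, \<open>v\<close> the
  value being accepted, and \<open>R\<close> the set of points still to be updated. Between main steps,
  \<open>A = acc L\<close> and \<open>R = {}\<close>.\<close>

definition marching :: "upwind_problem \<Rightarrow> gridpoint set \<Rightarrow> real \<Rightarrow> gridpoint set \<Rightarrow>
    (gridpoint \<Rightarrow> real) \<Rightarrow> (gridpoint \<Rightarrow> label) \<Rightarrow> bool" where
  "marching P A v R V L \<longleftrightarrow>
     A \<subseteq> acc L \<and> R \<inter> acc L = {} \<and> R \<subseteq> gridpts P \<and>
     (\<forall>x\<in>gridpts P. V x \<le> qfun P x) \<and>
     (\<forall>x\<in>gridpts P. residual P UNIV V (V x) x \<ge> 0) \<and>
     (\<forall>x\<in>gridpts P. residual P A V (V x) x \<le> 0) \<and>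
     (\<forall>x\<in>gridpts P - R. residual P (acc L) V (V x) x \<le> 0) \<and>
     (\<forall>x\<in>gridpts P \<inter> acc L. V x \<le> v) \<and>
     (\<forall>x\<in>gridpts P - A. v \<le> V x) \<and>
     (\<forall>x\<in>gridpts P. L x = Far \<longrightarrow> V x = qfun P x \<and> \<not> local_min P x) \<and>
     (\<forall>x\<in>gridpts P - R. L x = Far \<longrightarrow> nbrs P x \<inter> acc L = {})"

section \<open>Initialization, and updates within a main step\<close>

lemma marching_init:
  assumes "valid_problem P"
  shows "\<exists>v. marching P {} v {} (qfun P) (\<lambda>x. if local_min P x then Considered else Far)"
proof -
  have r: "rate P > 0" and fin: "finite (gridpts P)" using assms by (auto simp: valid_problem_def)
  have "slope P {} (qfun P) u x = 0" for u x
    by (cases x) (simp add: drop_to_def)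
  then have "residual P {} (qfun P) (qfun P x) x \<le> 0" if "x \<in> gridpts P" for x
    using assms that by (auto simp: residual_def neg_part_def valid_problem_def)
  moreover have "0 \<le> residual P UNIV (qfun P) (qfun P x) x" for x
    using r by (auto simp: residual_def neg_part_def divide_le_0_iff)
  moreover have "acc (\<lambda>x. if local_min P x then Considered else Far) = {}" by auto
  \<comment> \<open>No point is accepted yet, so any lower bound of \<open>qfun P\<close> on the
    grid can serve as \<open>v\<close>.\<close>
  moreover have "Min (qfun P ` gridpts P) \<le> qfun P x" if "x \<in> gridpts P" for x
    using fin that by simp
  ultimately show ?thesis
    by (intro exI[of _ "Min (qfun P ` gridpts P)"]) (auto simp: marching_def)
qed

text \<open>The old value has nonnegative residual and \<open>u\<close> has residual 0, so the value
  can only drop. A drop at \<open>y\<close> can only raise the full residual elsewhere, and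
  residuals that count accepted points alone do not see it, as \<open>y\<close> is not
  accepted.\<close>

lemma marching_update:
  assumes P: "valid_problem P" and inv: "marching P A v R V L" and y: "y \<in> R"
    and eq: "upwind_eq P (V(y := u)) y"
  shows "u \<le> V y"
    and "marching P A v (R - {y}) (V(y := u)) (if L y = Far then L(y := Considered) else L)"
proof -
  note M = inv[unfolded marching_def]
  have yX: "y \<in> gridpts P" and yacc: "L y \<noteq> Accepted" and yA: "y \<notin> A"
    using M y by blast+
  have above: "\<forall>x\<in>gridpts P - A. v \<le> V x" using M by blast
  let ?V = "V(y := u)" and ?L = "if L y = Far then L(y := Considered) else L"
  have accL: "acc ?L = acc L" using yacc by auto
  have res0: "residual P UNIV V u y = 0"
    using eq upwind_eq_upd_iff_residual[OF P yX] by blast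
  show le: "u \<le> V y"
  proof (rule ccontr)
    assume "\<not> u \<le> V y"
    then have "residual P UNIV V (V y) y < 0"
      using residual_strict_mono[OF P yX, of "V y" u UNIV V] res0 by simp
    moreover have "0 \<le> residual P UNIV V (V y) y" using M yX by blast
    ultimately show False by simp
  qed
  \<comment> \<open>If \<open>u < v\<close>, all neighbors below \<open>u\<close> lie in
    \<open>A\<close>, so \<open>u\<close> is a root of the residual counting \<open>A\<close> alone.
    The larger old value would then have positive residual there, against the subsolution
    property.\<close>
  have v: "v \<le> u"
  proof (rule ccontr)
    assume "\<not> v \<le> u"
    then have "residual P A V u y = residual P UNIV V u y"
    proof (intro residual_cong[OF P yX])
      fix n assume n: "n \<in> nbrs P y" "V n < u"
      have "n \<in> A"
      proof (rule ccontr)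
        assume "n \<notin> A"
        then have "v \<le> V n" using above nbrs_in_gridpts[OF n(1)] by blast
        then show False using n(2) \<open>\<not> v \<le> u\<close> by simp
      qed
      then show "n \<in> A \<longleftrightarrow> n \<in> UNIV" by simp
    qed
    moreover have "v \<le> V y" using above yX yA by blast
    then have "u < V y" using \<open>\<not> v \<le> u\<close> by simp
    ultimately have "0 < residual P A V (V y) y"
      using residual_strict_mono[OF P yX, of u "V y" A V] res0 by simp
    moreover have "residual P A V (V y) y \<le> 0" using M yX by blast
    ultimately show False by simp
  qed
  \<comment> \<open>Counting fewer neighbors can only lower the residual, which is 0 when all are
    counted.\<close>
  have sub: "residual P B ?V u y \<le> 0" for B
  proof -
    have "residual P B ?V u y - u \<le> residual P UNIV V u y - u"
      by (rule residual_mono[OF P yX]) (use nbrs_irrefl in force)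
    then show ?thesis using res0 by simp
  qed
  have same: "residual P B ?V (V x) x = residual P B V (V x) x"
    if "x \<in> gridpts P" "B \<subseteq> acc L" for x B
    by (rule residual_upd[OF P that(1)]) (use that yacc in blast)
  have super: "0 \<le> residual P UNIV ?V (?V x) x" if x: "x \<in> gridpts P" for x
  proof (cases "x = y")
    case True
    then show ?thesis using eq by (simp add: upwind_eq_iff_residual[OF P])
  next
    case False
    have "residual P UNIV V (V x) x - V x \<le> residual P UNIV ?V (V x) x - V x"
      by (rule residual_mono[OF P x]) (use le in auto)
    moreover have "0 \<le> residual P UNIV V (V x) x" using M x by blast
    ultimately show ?thesis using False by simp
  qed
  have subA: "residual P A ?V (?V x) x \<le> 0" if x: "x \<in> gridpts P" for x
  proof (cases "x = y")
    case True
    then show ?thesis using sub by simp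
  next
    case False
    have "A \<subseteq> acc L" "residual P A V (V x) x \<le> 0" using M x by blast+
    then show ?thesis using same[OF x] False by simp
  qed
  have subacc: "residual P (acc L) ?V (?V x) x \<le> 0" if x: "x \<in> gridpts P - (R - {y})" for x
  proof (cases "x = y")
    case True
    then show ?thesis using sub by simp
  next
    case False
    then have "residual P (acc L) V (V x) x \<le> 0" using M x by blast
    then show ?thesis using same[of x "acc L"] x False by simp
  qed
  show "marching P A v (R - {y}) ?V ?L"
    unfolding marching_def accL
  proof (intro conjI)
    have "V x \<le> qfun P x" if "x \<in> gridpts P" for x using M that by blast
    moreover from this[OF yX] have "u \<le> qfun P y" using le by simp
    ultimately show "\<forall>x\<in>gridpts P. ?V x \<le> qfun P x" by simp
    have "V x \<le> v" if "x \<in> gridpts P \<inter> acc L" for x using M that by blast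
    then show "\<forall>x\<in>gridpts P \<inter> acc L. ?V x \<le> v" using yacc by auto
    show "\<forall>x\<in>gridpts P - A. v \<le> ?V x" using above v by simp
    have "V x = qfun P x \<and> \<not> local_min P x" if "x \<in> gridpts P" "L x = Far" for x
      using M that by blast
    then show "\<forall>x\<in>gridpts P. ?L x = Far \<longrightarrow> ?V x = qfun P x \<and> \<not> local_min P x"
      by simp
    show "\<forall>x\<in>gridpts P - (R - {y}). ?L x = Far \<longrightarrow> nbrs P x \<inter> acc L = {}"
    proof (intro ballI impI)
      fix x assume "x \<in> gridpts P - (R - {y})" "?L x = Far"
      \<comment> \<open>\<open>y\<close> is no longer Far, so \<open>x\<close> differs from it and
        avoids all of \<open>R\<close>.\<close>
      then have "x \<in> gridpts P - R" "L x = Far" by (auto split: if_splits)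
      then show "nbrs P x \<inter> acc L = {}" using M by blast
    qed
    show "A \<subseteq> acc L" "(R - {y}) \<inter> acc L = {}" "R - {y} \<subseteq> gridpts P"
      using M by blast+
  qed (use super subA subacc in blast)+
qed

lemma marching_updates:
  assumes "fmm_updates P ys s s'" "valid_problem P" "distinct ys"
    and "marching P A v (set ys) (fst s) (snd s)"
  shows "marching P A v {} (fst s') (snd s')"
  using assms
proof (induction rule: fmm_updates.induct)
  case (Nil s)
  then show ?case by simp
next
  case (Cons V y u ys L s')
  have "marching P A v (set (y # ys) - {y}) (V(y := u)) (if L y = Far then L(y := Considered) else L)"
    using Cons.prems by (intro marching_update(2)[OF _ _ _ Cons.hyps(1)]) auto
  moreover have "set (y # ys) - {y} = set ys" using Cons.prems by auto
  ultimately show ?case using Cons.prems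
    by (intro Cons.IH) (simp_all only: fst_conv snd_conv distinct.simps)
qed

text \<open>A Far point with the smallest \<open>qfun\<close> is no local minimum, so it has a lower
  neighbor. That neighbor is not Far by minimality, and not Accepted because with \<open>R\<close>
  empty no Far point has an accepted neighbor.\<close>

lemma marching_far_above:
  assumes P: "valid_problem P" and inv: "marching P (acc L) v {} V L"
    and y: "y \<in> gridpts P" "L y = Far"
  obtains w where "w \<in> gridpts P" "L w = Considered" "V w < V y"
proof -
  note M = inv[unfolded marching_def]
  let ?F = "{x \<in> gridpts P. L x = Far}"
  have "finite ?F" using P by (simp add: valid_problem_def)
  moreover have "?F \<noteq> {}" using y by blast
  ultimately have "arg_min_on (qfun P) ?F \<in> ?F" "\<And>x. x \<in> ?F \<Longrightarrow> qfun P (arg_min_on (qfun P) ?F) \<le> qfun P x"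
    using arg_min_if_finite[of ?F "qfun P"] arg_min_least[of ?F _ "qfun P"] by auto
  then obtain z where z: "z \<in> gridpts P" "L z = Far" "\<And>x. x \<in> gridpts P \<Longrightarrow> L x = Far \<Longrightarrow> qfun P z \<le> qfun P x"
    by blast
  then have "\<not> local_min P z" using M by blast
  then obtain w where w: "w \<in> nbrs P z" "qfun P w < qfun P z"
    using z by (auto simp: local_min_def not_le)
  have wX: "w \<in> gridpts P" by (rule nbrs_in_gridpts[OF w(1)])
  have "L w \<noteq> Far" using z(3)[OF wX] w(2) by auto
  moreover have "L w \<noteq> Accepted" using M z w by blast
  ultimately have "L w = Considered" by (cases "L w") auto
  moreover have "V w \<le> qfun P w" "V y = qfun P y" using M wX y by blast+
  then have "V w < V y" using w(2) z(3)[OF y] by simp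
  ultimately show ?thesis using that wX by blast
qed

text \<open>\<open>V x\<close> is minimal among all unaccepted points: among Considered ones by
  choice, and each Far one lies above a Considered one. So it can replace \<open>v\<close>. Only the
  unaccepted neighbors of \<open>x\<close> can see the newly accepted point, and they await their
  update.\<close>

lemma marching_accept:
  assumes P: "valid_problem P" and inv: "marching P (acc L) v {} V L"
    and x: "x \<in> gridpts P" "L x = Considered" "\<forall>y\<in>gridpts P. L y = Considered \<longrightarrow> V x \<le> V y"
    and L': "L' = L(x := Accepted)"
  shows "marching P (acc L) (V x) {y \<in> nbrs P x. L' y \<noteq> Accepted} V L'"
proof -
  note M = inv[unfolded marching_def]
  let ?R = "{y \<in> nbrs P x. L' y \<noteq> Accepted}"
  have accL': "acc L' = insert x (acc L)" by (auto simp: L')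
  have "L x \<noteq> Accepted" using x(2) by simp
  then have v: "v \<le> V x" using M x(1) by blast
  have acc_le: "V y \<le> v" if "y \<in> gridpts P" "L y = Accepted" for y using M that by blast
  have above: "V x \<le> V y" if y: "y \<in> gridpts P - acc L" for y
  proof (cases "L y")
    case Far
    then obtain w where "w \<in> gridpts P" "L w = Considered" "V w < V y"
      using marching_far_above[OF P inv] y by blast
    then show ?thesis using x(3) by force
  qed (use y x(3) in auto)
  have sub: "residual P (acc L') V (V y) y \<le> 0" if y: "y \<in> gridpts P - ?R" for y
  proof -
    have "residual P (acc L') V (V y) y = residual P (acc L) V (V y) y"
    proof (rule residual_cong[OF P])
      fix n assume n: "n \<in> nbrs P y" "V n < V y"
      \<comment> \<open>A neighbor \<open>y\<close> of \<open>x\<close> outside the update set was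
        accepted earlier, so \<open>V y \<le> v \<le> V x\<close> and \<open>x\<close> is invisible
        from \<open>y\<close>.\<close>
      have "n \<noteq> x"
      proof
        assume "n = x"
        then have "y \<in> nbrs P x" using nbrs_sym n y by blast
        then have "L' y = Accepted" using y by blast
        moreover have "y \<noteq> x" using \<open>n = x\<close> n by auto
        ultimately have "V y \<le> v" using acc_le y by (simp add: L')
        then show False using v n \<open>n = x\<close> by simp
      qed
      then show "n \<in> acc L' \<longleftrightarrow> n \<in> acc L" by (auto simp: accL')
    qed (use y in blast)
    moreover have "residual P (acc L) V (V y) y \<le> 0" using M y by blast
    ultimately show ?thesis by simp
  qed
  have far: "nbrs P y \<inter> acc L' = {}" if y: "y \<in> gridpts P - ?R" "L' y = Far" for y
  proof -
    have "L y = Far" using y by (auto simp: L' split: if_splits)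
    then have "nbrs P y \<inter> acc L = {}" using M y by blast
    moreover have "x \<notin> nbrs P y"
      using nbrs_sym[of y P x] y by auto
    ultimately show ?thesis by (auto simp: accL')
  qed
  show ?thesis
    unfolding marching_def
  proof (intro conjI)
    show "?R \<subseteq> gridpts P" using nbrs_in_gridpts by blast
    show "\<forall>y\<in>gridpts P \<inter> acc L'. V y \<le> V x"
      using acc_le v by (auto simp: accL' intro: order_trans)
    have "V y = qfun P y \<and> \<not> local_min P y" if "y \<in> gridpts P" "L y = Far" for y
      using M that by blast
    then show "\<forall>y\<in>gridpts P. L' y = Far \<longrightarrow> V y = qfun P y \<and> \<not> local_min P y"
      by (simp add: L')
    show "acc L \<subseteq> acc L'" "?R \<inter> acc L' = {}" by (auto simp: accL' L')
    show "\<forall>y\<in>gridpts P. V y \<le> qfun P y" "\<forall>y\<in>gridpts P. 0 \<le> residual P UNIV V (V y) y"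
      "\<forall>y\<in>gridpts P. residual P (acc L) V (V y) y \<le> 0"
      using M by blast+
  qed (use above sub far in blast)+
qed

lemma marching_step:
  assumes P: "valid_problem P" and step: "fmm_step P s s'"
    and inv: "marching P (acc (snd s)) v {} (fst s) (snd s)"
  shows "\<exists>v'. marching P (acc (snd s')) v' {} (fst s') (snd s')"
  using step
proof cases
  case (1 x L V L' ys)
  have "marching P (acc L) (V x) (set ys) V L'"
    unfolding \<open>set ys = _\<close> by (rule marching_accept[OF P]) (use 1 inv in auto)
  then have "marching P (acc L) (V x) {} (fst s') (snd s')"
    using marching_updates[OF \<open>fmm_updates P ys _ _\<close> P \<open>distinct ys\<close>] by simp
  \<comment> \<open>With \<open>R\<close> empty the subsolution property counts all accepted points
    everywhere, so \<open>A\<close> may grow to include them.\<close>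
  then have "marching P (acc (snd s')) (V x) {} (fst s') (snd s')"
    unfolding marching_def by blast
  then show ?thesis by blast
qed

section \<open>Reachable states and the output\<close>

lemma marching_reachable:
  assumes P: "valid_problem P" and "(fmm_step P)\<^sup>*\<^sup>* (fmm_init P) s"
  shows "\<exists>v. marching P (acc (snd s)) v {} (fst s) (snd s)"
  using assms(2)
proof (induction rule: rtranclp_induct)
  case base
  have "acc (snd (fmm_init P)) = {}" by (auto simp: fmm_init_def)
  then show ?case using marching_init[OF P] by (simp add: fmm_init_def)
next
  case (step s s')
  then show ?case using marching_step[OF P] by blast
qed

text \<open>A remaining Far point would lie above a Considered one, so all points are accepted.
  Counting accepted neighbors is then counting all of them, and the sub- and supersolution
  inequalities meet.\<close>

lemma fmm_output_upwind_eq: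
  assumes P: "valid_problem P" and "fmm_output P V" and x: "x \<in> gridpts P"
  shows "upwind_eq P V x"
proof -
  obtain L where L: "(fmm_step P)\<^sup>*\<^sup>* (fmm_init P) (V, L)" "\<forall>x\<in>gridpts P. L x \<noteq> Considered"
    using assms(2) by (auto simp: fmm_output_def)
  obtain v where inv: "marching P (acc L) v {} V L" using marching_reachable[OF P L(1)] by auto
  note M = inv[unfolded marching_def]
  have all: "L y = Accepted" if y: "y \<in> gridpts P" for y
  proof (cases "L y")
    case Far
    then show ?thesis using marching_far_above[OF P inv y] L(2) by blast
  qed (use L(2) y in auto)
  have "residual P UNIV V (V x) x = residual P (acc L) V (V x) x"
    by (rule residual_cong[OF P x]) (use all nbrs_in_gridpts in blast)
  moreover have "residual P (acc L) V (V x) x \<le> 0" "0 \<le> residual P UNIV V (V x) x"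
    using M x by blast+
  ultimately show ?thesis by (simp add: upwind_eq_iff_residual[OF P])
qed


section \<open>Binary heaps\<close>

definition heap_items :: "heap \<Rightarrow> gridpoint set" where
  "heap_items H = heap_arr H ` {1..heap_size H}"

text \<open>Back pointers that invert the array also force the stored points to be distinct.\<close>

definition heap_wf :: "heap \<Rightarrow> bool" where
  "heap_wf H \<longleftrightarrow> (\<forall>i\<in>{1..heap_size H}. heap_pos H (heap_arr H i) = i)"

definition heap_ordered :: "(gridpoint \<Rightarrow> real) \<Rightarrow> heap \<Rightarrow> bool" where
  "heap_ordered V H \<longleftrightarrow>
     (\<forall>j\<in>{2..heap_size H}. V (heap_arr H (j div 2)) \<le> V (heap_arr H j))"

text \<open>The heap order may fail on the edge above \<open>i\<close> (resp. the edges below \<open>i\<close>); the second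
  conjunct compares the parent of \<open>i\<close> with the children of \<open>i\<close>, which an exchange
  at \<open>i\<close> makes adjacent.\<close>

definition ordered_but_up :: "(gridpoint \<Rightarrow> real) \<Rightarrow> nat \<Rightarrow> heap \<Rightarrow> bool" where
  "ordered_but_up V i H \<longleftrightarrow>
     (\<forall>j\<in>{2..heap_size H}. j \<noteq> i \<longrightarrow> V (heap_arr H (j div 2)) \<le> V (heap_arr H j)) \<and>
     (\<forall>j\<in>{2..heap_size H}. j div 2 = i \<and> 2 \<le> i \<longrightarrow> V (heap_arr H (i div 2)) \<le> V (heap_arr H j))"

definition ordered_but_down :: "(gridpoint \<Rightarrow> real) \<Rightarrow> nat \<Rightarrow> heap \<Rightarrow> bool" where
  "ordered_but_down V i H \<longleftrightarrow>
     (\<forall>j\<in>{2..heap_size H}. j div 2 \<noteq> i \<longrightarrow> V (heap_arr H (j div 2)) \<le> V (heap_arr H j)) \<and>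
     (\<forall>j\<in>{2..heap_size H}. j div 2 = i \<and> 2 \<le> i \<longrightarrow> V (heap_arr H (i div 2)) \<le> V (heap_arr H j))"

section \<open>Exchanges and sifting\<close>

lemma heap_wf_inj_on: "heap_wf H \<Longrightarrow> inj_on (heap_arr H) {1..heap_size H}"
  unfolding heap_wf_def by (metis inj_onI)

lemma card_heap_items: "heap_wf H \<Longrightarrow> card (heap_items H) = heap_size H"
  using card_image[OF heap_wf_inj_on] by (simp add: heap_items_def)

lemma heap_arr_swap:
  "heap_arr (heap_swap i j H) = (heap_arr H)(i := heap_arr H j, j := heap_arr H i)"
  by (cases H) simp

lemma heap_pos_swap:
  "heap_pos (heap_swap i j H) = (heap_pos H)(heap_arr H j := i, heap_arr H i := j)"
  by (cases H) simp

lemma heap_wf_swap: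
  assumes wf: "heap_wf H" and ij: "i \<in> {1..heap_size H}" "j \<in> {1..heap_size H}"
  shows "heap_wf (heap_swap i j H)"
  unfolding heap_wf_def heap_size_swap
proof
  fix k assume k: "k \<in> {1..heap_size H}"
  have eq: "heap_arr H a = heap_arr H b \<longleftrightarrow> a = b"
    if "a \<in> {1..heap_size H}" "b \<in> {1..heap_size H}" for a b
    using inj_on_eq_iff[OF heap_wf_inj_on[OF wf]] that by blast
  show "heap_pos (heap_swap i j H) (heap_arr (heap_swap i j H) k) = k"
    using wf k ij eq[OF k ij(1)] eq[OF k ij(2)] eq[OF ij] eq[OF ij(2,1)]
    by (simp add: heap_arr_swap heap_pos_swap heap_wf_def)
qed

lemma heap_items_swap:
  assumes "i \<in> {1..heap_size H}" "j \<in> {1..heap_size H}"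
  shows "heap_items (heap_swap i j H) = heap_items H"
proof -
  have "heap_arr H k \<in> heap_items (heap_swap i j H)" if "k \<in> {1..heap_size H}" for k
    unfolding heap_items_def
    \<comment> \<open>An exchange is its own inverse, which gives the preimage index.\<close>
    by (rule image_eqI[of _ _ "if k = i then j else if k = j then i else k"])
      (use assms that in \<open>auto simp: heap_arr_swap\<close>)
  moreover have "heap_arr (heap_swap i j H) k \<in> heap_items H" if "k \<in> {1..heap_size H}" for k
    using assms that by (auto simp: heap_arr_swap heap_items_def)
  ultimately show ?thesis by (auto simp: heap_items_def)
qed

text \<open>An exchange moves the only possible violation from the edge above \<open>i\<close> to
  the edge above \<open>i div 2\<close>. Each level halves the index; the bound on
  \<open>2 ^ c\<close> records this without logarithms.\<close>

lemma sift_up_correct: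
  assumes "sift_up V i H = (H', c)" "heap_wf H" "i \<in> {1..heap_size H}" "ordered_but_up V i H"
  shows "heap_wf H' \<and> heap_items H' = heap_items H \<and> heap_size H' = heap_size H \<and>
    heap_ordered V H' \<and> 2 ^ c \<le> 2 * i"
  using assms
proof (induction V i H arbitrary: H' c rule: sift_up.induct)
  case (1 V i H)
  show ?case
  proof (cases "i \<le> 1 \<or> V (heap_arr H (i div 2)) \<le> V (heap_arr H i)")
    case True
    then have "H' = H" "c = 1" using "1.prems"(1) by (auto simp: sift_up.simps[of V i H])
    moreover have "heap_ordered V H"
      unfolding heap_ordered_def
    proof
      fix j assume "j \<in> {2..heap_size H}"
      then show "V (heap_arr H (j div 2)) \<le> V (heap_arr H j)"
        using "1.prems"(4) True by (cases "j = i") (auto simp: ordered_but_up_def)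
    qed
    ultimately show ?thesis using 1 by simp
  next
    case False
    let ?p = "i div 2" and ?S = "heap_swap i (i div 2) H"
    have p: "?p \<in> {1..heap_size H}" "?p \<noteq> i" using False "1.prems"(3) by auto
    obtain c' where S: "sift_up V ?p ?S = (H', c')" and c: "c = Suc c'"
      using False "1.prems"(1) by (auto simp: sift_up.simps[of V i H] split: prod.splits)
    have "ordered_but_up V ?p ?S"
      unfolding ordered_but_up_def heap_size_swap
    proof (intro conjI ballI impI)
      fix j assume j: "j \<in> {2..heap_size H}" and "j \<noteq> ?p"
      have lt: "V (heap_arr H i) < V (heap_arr H ?p)" using False by simp
      have up: "V (heap_arr H (j div 2)) \<le> V (heap_arr H j)" if "j \<noteq> i"
        using "1.prems"(4) j that by (auto simp: ordered_but_up_def)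
      show "V (heap_arr ?S (j div 2)) \<le> V (heap_arr ?S j)"
      proof (cases "j = i")
        case True
        then show ?thesis using lt p(2) by (simp add: heap_arr_swap)
      next
        case ji: False
        then have Sj: "heap_arr ?S j = heap_arr H j" using \<open>j \<noteq> ?p\<close> by (simp add: heap_arr_swap)
        show ?thesis
        proof (cases "j div 2 = i")
          case True
          \<comment> \<open>The old parent, now at \<open>i\<close>, sits directly above its former
            grandchild \<open>j\<close>; the second conjunct compares these two.\<close>
          then have "V (heap_arr H ?p) \<le> V (heap_arr H j)"
            using "1.prems"(4) False j by (auto simp: ordered_but_up_def)
          then show ?thesis using True p(2) unfolding Sj by (simp add: heap_arr_swap)
        next
          case False
          then show ?thesis using up[OF ji] lt unfolding Sj by (auto simp: heap_arr_swap)
        qed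
      qed
    next
      fix j assume j: "j \<in> {2..heap_size H}" and jp: "j div 2 = ?p \<and> 2 \<le> ?p"
      have "V (heap_arr H (?p div 2)) \<le> V (heap_arr H ?p)"
        using "1.prems"(4) p jp by (auto simp: ordered_but_up_def)
      moreover have "V (heap_arr H (j div 2)) \<le> V (heap_arr H j)" if "j \<noteq> i"
        using "1.prems"(4) j that by (auto simp: ordered_but_up_def)
      moreover have "?p div 2 \<noteq> ?p" "?p div 2 \<noteq> i" "j \<noteq> ?p" using jp by auto
      ultimately show "V (heap_arr ?S (?p div 2)) \<le> V (heap_arr ?S j)"
        using jp p(2) by (auto simp: heap_arr_swap)
    qed
    then have "heap_wf H' \<and> heap_items H' = heap_items ?S \<and> heap_size H' = heap_size ?S \<and>
        heap_ordered V H' \<and> 2 ^ c' \<le> 2 * ?p"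
      using "1.IH"[OF False S] heap_wf_swap[OF "1.prems"(2,3) p(1)] p(1) by simp
    then show ?thesis
      using heap_items_swap[OF "1.prems"(3) p(1)] by (auto simp: c)
  qed
qed

text \<open>Exchanging with the smaller child moves the violation below that child. The index at
  least doubles per level, hence the factor \<open>i\<close> in the bound; \<open>max\<close> covers
  an index beyond the end, as in an emptied heap.\<close>

lemma sift_down_correct:
  assumes "sift_down V i H = (H', c)" "heap_wf H" "1 \<le> i" "ordered_but_down V i H"
  shows "heap_wf H' \<and> heap_items H' = heap_items H \<and> heap_size H' = heap_size H \<and>
    heap_ordered V H' \<and> 2 ^ c * i \<le> 2 * max i (heap_size H)"
  using assms
proof (induction V i H arbitrary: H' c rule: sift_down.induct)
  case (1 V i H)
  let ?m = "min_child V i H"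
  have m_le: "V (heap_arr H ?m) \<le> V (heap_arr H j)" if "j \<in> {2..heap_size H}" "j div 2 = i" for j
  proof -
    have "j = 2 * i \<or> j = 2 * i + 1" using that(2) by auto
    then show ?thesis using that by (auto simp: min_child_def)
  qed
  show ?case
  proof (cases "i = 0 \<or> heap_size H < 2 * i \<or> V (heap_arr H i) \<le> V (heap_arr H ?m)")
    case True
    then have "H' = H" "c = 1" using "1.prems"(1) by (auto simp: sift_down.simps[of V i H])
    moreover have "heap_ordered V H"
      unfolding heap_ordered_def
    proof
      fix j assume j: "j \<in> {2..heap_size H}"
      show "V (heap_arr H (j div 2)) \<le> V (heap_arr H j)"
      proof (cases "j div 2 = i")
        case True
        then have "V (heap_arr H i) \<le> V (heap_arr H ?m)"
          using \<open>i = 0 \<or> _\<close> j by auto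
        then show ?thesis using m_le[OF j True] True by simp
      next
        case False
        then show ?thesis using "1.prems"(4) j by (auto simp: ordered_but_down_def)
      qed
    qed
    ultimately show ?thesis using 1 by simp
  next
    case False
    let ?S = "heap_swap i ?m H"
    have m: "?m \<in> {1..heap_size H}" "?m \<noteq> i" "?m div 2 = i" "2 * i \<le> ?m"
      using False by (auto simp: min_child_def)
    have i: "i \<in> {1..heap_size H}" using False by auto
    obtain c' where S: "sift_down V ?m ?S = (H', c')" and c: "c = Suc c'"
      using False "1.prems"(1) by (auto simp: sift_down.simps[of V i H] split: prod.splits)
    have "ordered_but_down V ?m ?S"
      unfolding ordered_but_down_def heap_size_swap
    proof (intro conjI ballI impI)
      fix j assume j: "j \<in> {2..heap_size H}" and jm: "j div 2 \<noteq> ?m"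
      have o: "V (heap_arr H (j div 2)) \<le> V (heap_arr H j)" if "j div 2 \<noteq> i"
        using "1.prems"(4) j that by (auto simp: ordered_but_down_def)
      show "V (heap_arr ?S (j div 2)) \<le> V (heap_arr ?S j)"
      proof (cases "j = i")
        case True
        \<comment> \<open>The smaller child has moved up to \<open>i\<close> and now meets the
          parent of \<open>i\<close>, an edge covered by the second conjunct.\<close>
        have "V (heap_arr H (i div 2)) \<le> V (heap_arr H ?m)"
          using "1.prems"(4) m j True by (auto simp: ordered_but_down_def)
        moreover have "i div 2 \<noteq> i" using i by auto
        ultimately show ?thesis using True m jm by (simp add: heap_arr_swap)
      next
        case False
        show ?thesis
        proof (cases "j = ?m")
          case True
          then show ?thesis using m \<open>\<not> (i = 0 \<or> _)\<close> by (simp add: heap_arr_swap)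
        next
          case False
          then show ?thesis using \<open>j \<noteq> i\<close> o m_le[OF j] jm m(2) by (auto simp: heap_arr_swap)
        qed
      qed
    next
      fix j assume j: "j \<in> {2..heap_size H}" and jm: "j div 2 = ?m \<and> 2 \<le> ?m"
      have "j div 2 \<noteq> i" using jm m(2) by simp
      then have "V (heap_arr H (j div 2)) \<le> V (heap_arr H j)"
        using "1.prems"(4) j unfolding ordered_but_down_def by blast
      moreover have "j \<noteq> i" "j \<noteq> ?m" using jm m i by auto
      ultimately show "V (heap_arr ?S (?m div 2)) \<le> V (heap_arr ?S j)"
        using jm m by (simp add: heap_arr_swap)
    qed
    then have IH: "heap_wf H' \<and> heap_items H' = heap_items ?S \<and> heap_size H' = heap_size ?S \<and>
        heap_ordered V H' \<and> 2 ^ c' * ?m \<le> 2 * max ?m (heap_size ?S)"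
      using "1.IH"[OF False S] heap_wf_swap[OF "1.prems"(2) i m(1)] m(1) by simp
    have "2 ^ c * i = 2 ^ c' * (2 * i)" by (simp add: c)
    also have "\<dots> \<le> 2 ^ c' * ?m" using m(4) by simp
    also have "\<dots> \<le> 2 * max i (heap_size H)" using IH m(1) i by (simp add: max_def)
    finally show ?thesis
      using IH heap_items_swap[OF i m(1)] by simp
  qed
qed

section \<open>The operations on the Considered list\<close>

lemma heap_insert_correct:
  assumes "heap_insert V x H = (H', c)" "heap_wf H" "heap_ordered V H" "x \<notin> heap_items H"
  shows "heap_wf H'" "heap_items H' = insert x (heap_items H)" "heap_ordered V H'"
    "2 ^ c \<le> 2 * heap_size H'"
proof -
  obtain A B n where H: "H = (A, B, n)" by (cases H)
  let ?S = "(A(n + 1 := x), B(x := n + 1), n + 1)"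
  have S: "sift_up V (n + 1) ?S = (H', c)" using assms(1) by (simp add: H)
  have "A i \<noteq> x" if "i \<in> {1..n}" for i
    using assms(4) that by (auto simp: H heap_items_def)
  then have "heap_wf ?S"
    using assms(2) by (auto simp: H heap_wf_def)
  moreover have "heap_items ?S = insert x (heap_items H)"
    by (fastforce simp: H heap_items_def atLeastAtMostSuc_conv)
  \<comment> \<open>The new leaf has no children, so only the edge above it can fail.\<close>
  moreover have "ordered_but_up V (n + 1) ?S"
    using assms(3) by (auto simp: H heap_ordered_def ordered_but_up_def)
  ultimately show "heap_wf H'" "heap_items H' = insert x (heap_items H)" "heap_ordered V H'"
    "2 ^ c \<le> 2 * heap_size H'"
    using sift_up_correct[OF S] by auto
qed

text \<open>The order holds for the old keys and only the key of \<open>y\<close> drops. Every edge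
  except the one above \<open>y\<close> keeps its lower key, while its upper key does not
  grow.\<close>

lemma heap_decrease_key_correct:
  assumes "heap_decrease_key (V(y := u)) y H = (H', c)" "heap_wf H" "heap_ordered V H"
    and "y \<in> heap_items H" "u \<le> V y"
  shows "heap_wf H'" "heap_items H' = heap_items H" "heap_ordered (V(y := u)) H'"
    "2 ^ c \<le> 2 * heap_size H'"
proof -
  obtain i where i: "i \<in> {1..heap_size H}" "heap_arr H i = y"
    using assms(4) by (auto simp: heap_items_def)
  then have pos: "heap_pos H y = i" using assms(2) by (auto simp: heap_wf_def)
  have S: "sift_up (V(y := u)) i H = (H', c)"
    using assms(1) by (simp add: heap_decrease_key_def pos)
  have eq: "heap_arr H j = y \<longleftrightarrow> j = i" if "j \<in> {1..heap_size H}" for j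
    using inj_on_eq_iff[OF heap_wf_inj_on[OF assms(2)] that i(1)] i(2) by simp
  have le: "(V(y := u)) z \<le> V z" for z using assms(5) by simp
  have ord: "V (heap_arr H (j div 2)) \<le> V (heap_arr H j)" if "j \<in> {2..heap_size H}" for j
    using assms(3) that by (simp add: heap_ordered_def)
  have "ordered_but_up (V(y := u)) i H"
    unfolding ordered_but_up_def
  proof (intro conjI ballI impI)
    fix j assume j: "j \<in> {2..heap_size H}" "j \<noteq> i"
    then have "(V(y := u)) (heap_arr H j) = V (heap_arr H j)" using eq[of j] by auto
    then show "(V(y := u)) (heap_arr H (j div 2)) \<le> (V(y := u)) (heap_arr H j)"
      using le[of "heap_arr H (j div 2)"] ord[OF j(1)] by linarith
  next
    fix j assume j: "j \<in> {2..heap_size H}" "j div 2 = i \<and> 2 \<le> i"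
    then have "(V(y := u)) (heap_arr H j) = V (heap_arr H j)" using eq[of j] by auto
    moreover have "V (heap_arr H (i div 2)) \<le> V (heap_arr H i)" using ord[of i] i(1) j(2) by auto
    ultimately show "(V(y := u)) (heap_arr H (i div 2)) \<le> (V(y := u)) (heap_arr H j)"
      using le[of "heap_arr H (i div 2)"] ord[OF j(1)] j(2) by simp
  qed
  then show "heap_wf H'" "heap_items H' = heap_items H" "heap_ordered (V(y := u)) H'"
    "2 ^ c \<le> 2 * heap_size H'"
    using sift_up_correct[OF S assms(2) i(1)] i(1) by auto
qed

lemma heap_delete_min_correct:
  assumes "heap_delete_min V H = (H', c)" "heap_wf H" "heap_ordered V H" "heap_size H \<noteq> 0"
  shows "heap_wf H'" "heap_items H' = heap_items H - {heap_arr H 1}" "heap_ordered V H'"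
    "2 ^ c \<le> 2 * heap_size H"
proof -
  let ?n = "heap_size H"
  let ?W = "heap_swap 1 ?n H"
  have size: "heap_size (shrink G) = heap_size G - 1" and arr: "heap_arr (shrink G) = heap_arr G"
    and pos: "heap_pos (shrink G) = heap_pos G" for G by (cases G; simp)+
  have n: "1 \<in> {1..?n}" "?n \<in> {1..?n}" using assms(4) by auto
  have W: "heap_wf ?W" by (rule heap_wf_swap[OF assms(2) n])
  then have wf: "heap_wf (shrink ?W)" by (auto simp: heap_wf_def size arr pos)
  \<comment> \<open>The former last leaf now sits at the root, so only edges below index 1 can
    fail.\<close>
  have ord: "ordered_but_down V 1 (shrink ?W)"
    using assms(3) by (auto simp: ordered_but_down_def heap_ordered_def size arr heap_arr_swap)
  have "heap_items (shrink ?W) = heap_items H - {heap_arr H 1}"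
  proof -
    \<comment> \<open>The exchange put the old minimum at the last index, and by injectivity
      dropping that index removes exactly this item.\<close>
    have "{1..?n} = insert ?n {1..?n - 1}" using assms(4) by auto
    then have "heap_items (shrink ?W) = heap_arr ?W ` ({1..?n} - {?n})"
      by (auto simp: heap_items_def size arr)
    also have "\<dots> = heap_arr ?W ` {1..?n} - heap_arr ?W ` {?n}"
      using heap_wf_inj_on[OF W] n by (intro inj_on_image_set_diff[of _ "{1..?n}"]) auto
    also have "heap_arr ?W ` {1..?n} = heap_items H"
      using heap_items_swap[OF n] by (simp add: heap_items_def)
    finally show ?thesis by (simp add: heap_arr_swap)
  qed
  moreover have sift: "heap_wf H' \<and> heap_items H' = heap_items (shrink ?W) \<and>
      heap_size H' = heap_size (shrink ?W) \<and> heap_ordered V H' \<and>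
      2 ^ c * 1 \<le> 2 * max 1 (heap_size (shrink ?W))"
    by (rule sift_down_correct[OF assms(1)[unfolded heap_delete_min_def] wf _ ord]) simp
  ultimately show "heap_wf H'" "heap_items H' = heap_items H - {heap_arr H 1}" "heap_ordered V H'"
    by simp_all
  have "max 1 (heap_size (shrink ?W)) \<le> heap_size H" using assms(4) by (simp add: size)
  then show "2 ^ c \<le> 2 * heap_size H" using sift by linarith
qed

lemma heap_min:
  assumes "heap_ordered V H" "1 \<le> i" "i \<le> heap_size H"
  shows "V (heap_arr H 1) \<le> V (heap_arr H i)"
  using assms(2,3)
proof (induction i rule: less_induct)
  case (less i)
  show ?case
  proof (cases "i = 1")
    case False
    then have "V (heap_arr H 1) \<le> V (heap_arr H (i div 2))"
      using less by (intro less.IH) auto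
    also have "\<dots> \<le> V (heap_arr H i)"
      using assms(1) less.prems False by (auto simp: heap_ordered_def)
    finally show ?thesis .
  qed simp
qed


section \<open>The method with a heap\<close>

definition heap_of :: "upwind_problem \<Rightarrow> (gridpoint \<Rightarrow> real) \<Rightarrow> (gridpoint \<Rightarrow> label) \<Rightarrow> heap \<Rightarrow> bool" where
  "heap_of P V L H \<longleftrightarrow> heap_wf H \<and> heap_ordered V H \<and>
     heap_items H = {x \<in> gridpts P. L x = Considered}"

section \<open>Agreement of the heap version with the method, and its cost\<close>

lemma heap_of_size:
  assumes "valid_problem P" "heap_of P V L H"
  shows "heap_size H \<le> card (gridpts P)"
proof -
  have "card (heap_items H) \<le> card (gridpts P)"
    using assms by (intro card_mono) (auto simp: valid_problem_def heap_of_def)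
  moreover have "heap_wf H" using assms(2) by (simp add: heap_of_def)
  ultimately show ?thesis by (simp add: card_heap_items)
qed

text \<open>\<open>b\<close> bounds the cost of one heap operation. It is specified through powers
  of 2, which is the form the sifting bounds have, so logarithms enter only at the end.\<close>

lemma heap_init_correct:
  assumes P: "valid_problem P" and b: "\<And>k. 2 ^ k \<le> 2 * card (gridpts P) \<Longrightarrow> k \<le> b"
    and "distinct xs" "set xs \<subseteq> gridpts P" "\<forall>x\<in>set xs. L x = Far" "heap_of P V L H"
    and "fold (heap_mark P) xs (V, L, H, c) = (V', L', H', c')"
  shows "V' = V \<and> L' = (\<lambda>x. if x \<in> set xs \<and> local_min P x then Considered else L x) \<and>
    heap_of P V L' H' \<and> c' \<le> c + length xs * (1 + b)"
  using assms(3-)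
proof (induction xs arbitrary: L H c)
  case Nil
  then show ?case by simp
next
  case (Cons x xs)
  show ?case
  proof (cases "local_min P x")
    case False
    then have "fold (heap_mark P) xs (V, L, H, c + 1) = (V', L', H', c')"
      using Cons.prems by simp
    then have "V' = V \<and> L' = (\<lambda>x. if x \<in> set xs \<and> local_min P x then Considered else L x) \<and>
        heap_of P V L' H' \<and> c' \<le> c + 1 + length xs * (1 + b)"
      using Cons.prems by (intro Cons.IH) auto
    then show ?thesis using False by (auto simp: fun_eq_iff)
  next
    case True
    obtain H1 d where ins: "heap_insert V x H = (H1, d)" by (cases "heap_insert V x H")
    let ?L = "L(x := Considered)"
    have "x \<notin> heap_items H" using Cons.prems by (auto simp: heap_of_def)
    then have H1: "heap_wf H1" "heap_items H1 = insert x (heap_items H)" "heap_ordered V H1"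
      "2 ^ d \<le> 2 * heap_size H1"
      using heap_insert_correct[OF ins] Cons.prems by (auto simp: heap_of_def)
    have H1ok: "heap_of P V ?L H1"
      using H1 Cons.prems by (auto simp: heap_of_def)
    have d: "d \<le> b"
      using heap_of_size[OF P H1ok] H1(4) by (intro b) linarith
    have F: "fold (heap_mark P) xs (V, ?L, H1, c + 1 + d) = (V', L', H', c')"
      using Cons.prems True ins by simp
    have "V' = V \<and> L' = (\<lambda>z. if z \<in> set xs \<and> local_min P z then Considered else ?L z) \<and>
        heap_of P V L' H' \<and> c' \<le> c + 1 + d + length xs * (1 + b)"
      using Cons.prems(1-3) by (intro Cons.IH[OF _ _ _ H1ok F]) auto
    then show ?thesis using True d by (auto simp: fun_eq_iff)
  qed
qed

text \<open>The marching invariant is carried along because it shows that the local solve never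
  raises a value, which \<open>heap_decrease_key\<close> relies on.\<close>

lemma heap_updates_correct:
  assumes P: "valid_problem P" and b: "\<And>k. 2 ^ k \<le> 2 * card (gridpts P) \<Longrightarrow> k \<le> b"
    and "distinct ys" "marching P A v (set ys) V L" "heap_of P V L H"
    and "fold (heap_update P) ys (V, L, H, c) = (V', L', H', c')"
  shows "fmm_updates P ys (V, L) (V', L') \<and> heap_of P V' L' H' \<and> acc L' = acc L \<and>
    c' \<le> c + length ys * (1 + b)"
  using assms(3-)
proof (induction ys arbitrary: V L H c)
  case Nil
  then show ?case by (auto intro: fmm_updates.Nil)
next
  case (Cons y ys)
  have "set (y # ys) \<inter> acc L = {} \<and> set (y # ys) \<subseteq> gridpts P"
    using Cons.prems(2) unfolding marching_def by blast
  then have y: "y \<in> gridpts P" "L y \<noteq> Accepted" by auto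
  let ?u = "local_solve P V y"
  let ?V = "V(y := ?u)" and ?L = "if L y = Far then L(y := Considered) else L"
  have eq: "upwind_eq P ?V y" by (rule upwind_eq_local_solve[OF P y(1)])
  have le: "?u \<le> V y"
    by (rule marching_update(1)[OF P Cons.prems(2) _ eq]) simp
  have "marching P A v (set (y # ys) - {y}) ?V ?L"
    by (rule marching_update(2)[OF P Cons.prems(2) _ eq]) simp
  moreover have "set (y # ys) - {y} = set ys" using Cons.prems by auto
  ultimately have inv: "marching P A v (set ys) ?V ?L" by simp
  have ok: "heap_wf H" "heap_ordered V H" "heap_items H = {x \<in> gridpts P. L x = Considered}"
    using Cons.prems(3) by (auto simp: heap_of_def)
  obtain H1 d where step: "heap_update P y (V, L, H, c) = (?V, ?L, H1, c + 1 + d)"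
    and H1: "heap_of P ?V ?L H1" "2 ^ d \<le> 2 * heap_size H1"
  proof (cases "L y = Far")
    case True
    obtain H1 d where ins: "heap_insert ?V y H = (H1, d)" by (cases "heap_insert ?V y H")
    have "y \<notin> heap_items H" using ok(3) True by simp
    \<comment> \<open>\<open>y\<close> is not stored, so changing its key leaves the order of the
      heap intact.\<close>
    moreover from this have "heap_ordered ?V H"
      using ok(2) by (force simp: heap_ordered_def heap_items_def)
    ultimately have "heap_wf H1" "heap_items H1 = insert y (heap_items H)"
      "heap_ordered ?V H1" "2 ^ d \<le> 2 * heap_size H1"
      using heap_insert_correct[OF ins ok(1)] by auto
    moreover from this have "heap_of P ?V ?L H1"
      using ok(3) y True by (auto simp: heap_of_def)
    ultimately show ?thesis using that[of H1 d] True ins by (simp add: Let_def)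
  next
    case False
    obtain H1 d where dec: "heap_decrease_key ?V y H = (H1, d)"
      by (cases "heap_decrease_key ?V y H")
    have "L y = Considered" using False y(2) by (cases "L y") auto
    then have "y \<in> heap_items H" using ok(3) y(1) by simp
    then have "heap_wf H1" "heap_items H1 = heap_items H"
      "heap_ordered ?V H1" "2 ^ d \<le> 2 * heap_size H1"
      using heap_decrease_key_correct[OF dec ok(1,2)] le by auto
    then show ?thesis using that[of H1 d] False dec ok(3) by (simp add: Let_def heap_of_def)
  qed
  have d: "d \<le> b"
    using heap_of_size[OF P H1(1)] H1(2) by (intro b) linarith
  have F: "fold (heap_update P) ys (?V, ?L, H1, c + 1 + d) = (V', L', H', c')"
    using Cons.prems(4) step by (simp del: heap_update.simps)
  have "fmm_updates P ys (?V, ?L) (V', L') \<and> heap_of P V' L' H' \<and> acc L' = acc ?L \<and>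
      c' \<le> c + 1 + d + length ys * (1 + b)"
    using Cons.prems(1) by (intro Cons.IH[OF _ inv H1(1) F]) simp
  moreover have "acc ?L = acc L" using y(2) by auto
  ultimately show ?case using fmm_updates.Cons[OF eq] d by auto
qed

text \<open>One deletion and at most four neighbor updates, each costing at most
  \<open>1 + b\<close>, give the factor 5. The accepted point is exposed because it pays for the
  step.\<close>

lemma heap_fmm_step_correct:
  assumes P: "valid_problem P" and b: "\<And>k. 2 ^ k \<le> 2 * card (gridpts P) \<Longrightarrow> k \<le> b"
    and inv: "marching P (acc L) v {} V L" and H: "heap_of P V L H" "heap_size H \<noteq> 0"
    and step: "heap_fmm_step P (V, L, H, c) = (V', L', H', c')"
  obtains x where "fmm_step P (V, L) (V', L')" "heap_of P V' L' H'" "c' \<le> c + 5 * (1 + b)"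
    and "x \<in> gridpts P - acc L" "acc L' = insert x (acc L)"
proof -
  have ok: "heap_wf H" "heap_ordered V H" "heap_items H = {x \<in> gridpts P. L x = Considered}"
    using H(1) by (auto simp: heap_of_def)
  define x where "x = heap_arr H 1"
  let ?L = "L(x := Accepted)"
  let ?ys = "filter (\<lambda>y. ?L y \<noteq> Accepted) (nbr_list P x)"
  obtain H1 d where del: "heap_delete_min V H = (H1, d)" by (cases "heap_delete_min V H")
  have "x \<in> heap_items H" using H(2) by (simp add: heap_items_def x_def)
  then have x: "x \<in> gridpts P" "L x = Considered" using ok(3) by auto
  have min: "\<forall>y\<in>gridpts P. L y = Considered \<longrightarrow> V x \<le> V y"
  proof (intro ballI impI)
    fix y assume "y \<in> gridpts P" "L y = Considered"
    then have "y \<in> heap_items H" using ok(3) by simp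
    then show "V x \<le> V y" using heap_min[OF ok(2)] by (auto simp: heap_items_def x_def)
  qed
  have H1: "heap_of P V ?L H1"
    using heap_delete_min_correct[OF del ok(1,2) H(2)] ok(3) by (auto simp: heap_of_def x_def)
  have "2 ^ d \<le> 2 * heap_size H"
    using heap_delete_min_correct[OF del ok(1,2) H(2)] by simp
  then have d: "d \<le> b" using heap_of_size[OF P H(1)] by (intro b) linarith
  have ys: "set ?ys = {y \<in> nbrs P x. ?L y \<noteq> Accepted}" by auto
  have "fold (heap_update P) ?ys (V, ?L, H1, c + 1 + d) = (V', L', H', c')"
    using step del by (simp add: Let_def x_def)
  moreover have "marching P (acc L) (V x) (set ?ys) V ?L"
    unfolding ys by (rule marching_accept[OF P inv x min refl])
  moreover have dist: "distinct ?ys" by (simp add: distinct_nbr_list)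
  ultimately have upd: "fmm_updates P ?ys (V, ?L) (V', L') \<and> heap_of P V' L' H' \<and>
      acc L' = acc ?L \<and> c' \<le> c + 1 + d + length ?ys * (1 + b)"
    using heap_updates_correct[OF P b] H1 by blast
  have "fmm_step P (V, L) (V', L')"
    using fmm_step.intros[OF x min refl dist ys] upd by blast
  moreover have "length ?ys * (1 + b) \<le> 4 * (1 + b)"
    by (intro mult_right_mono order_trans[OF length_filter_le length_nbr_list]) simp
  ultimately show ?thesis
    using upd d x by (intro that[of x]) auto
qed

text \<open>Per gridpoint, initialization costs at most \<open>2 + b\<close> and acceptance at most
  \<open>5 * (1 + b)\<close>, in total \<open>7 + 6 * b\<close>. The number of unaccepted points is
  both the termination measure and the remaining budget.\<close>

lemma heap_fmm_correct:
  assumes P: "valid_problem P" and b: "\<And>k. 2 ^ k \<le> 2 * card (gridpts P) \<Longrightarrow> k \<le> b"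
    and xs: "distinct xs" "set xs = gridpts P"
  obtains V L H c where "heap_fmm P xs = Some (V, L, H, c)" "fmm_output P V"
    "c \<le> card (gridpts P) * (7 + 6 * b)"
proof -
  let ?M = "card (gridpts P)"
  let ?todo = "\<lambda>(V, L, H, c). card (gridpts P - acc L)"
  \<comment> \<open>Every main step accepts a point, which pays for the step.\<close>
  define I where "I = (\<lambda>(V, L, H, c). (fmm_step P)\<^sup>*\<^sup>* (fmm_init P) (V, L) \<and> heap_of P V L H \<and>
      c + card (gridpts P - acc L) * (5 * (1 + b)) \<le> ?M * (7 + 6 * b))"
  have fin: "finite (gridpts P)" using P by (simp add: valid_problem_def)
  have init: "I (heap_fmm_init P xs)"
  proof -
    obtain V L H c where s: "heap_fmm_init P xs = (V, L, H, c)" by (cases "heap_fmm_init P xs")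
    have "heap_of P (qfun P) (\<lambda>_. Far) (\<lambda>_. undefined, \<lambda>_. undefined, 0)"
      by (simp add: heap_of_def heap_wf_def heap_ordered_def heap_items_def)
    then have 1: "V = qfun P" "heap_of P (qfun P) L H" "c \<le> length xs + length xs * (1 + b)"
      and L: "L = (\<lambda>x. if x \<in> set xs \<and> local_min P x then Considered else Far)"
      using heap_init_correct[OF P b xs(1) _ _ _ s[unfolded heap_fmm_init_def]] xs(2) by auto
    have "L = (\<lambda>x. if local_min P x then Considered else Far)"
      using L xs(2) by (auto simp: local_min_def)
    then have "(V, L) = fmm_init P" using 1(1) by (simp add: fmm_init_def)
    moreover have "card (gridpts P - acc L) \<le> ?M" using fin by (intro card_mono) auto
    then have "card (gridpts P - acc L) * (5 * (1 + b)) \<le> ?M * (5 * (1 + b))"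
      by (rule mult_right_mono) simp
    moreover have "length xs = ?M" using xs distinct_card by force
    ultimately show ?thesis using 1 by (simp add: s I_def algebra_simps)
  qed
  have step: "I (heap_fmm_step P s) \<and> ?todo (heap_fmm_step P s) < ?todo s"
    if I: "I s" and cond: "(\<lambda>(V, L, H, c). heap_size H \<noteq> 0) s" for s
  proof -
    obtain V L H c where s: "s = (V, L, H, c)" by (cases s)
    obtain V' L' H' c' where s': "heap_fmm_step P (V, L, H, c) = (V', L', H', c')"
      by (cases "heap_fmm_step P (V, L, H, c)")
    have reach: "(fmm_step P)\<^sup>*\<^sup>* (fmm_init P) (V, L)" and H: "heap_of P V L H"
      and pot: "c + card (gridpts P - acc L) * (5 * (1 + b)) \<le> ?M * (7 + 6 * b)"
      using I by (auto simp: I_def s)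
    obtain v where inv: "marching P (acc L) v {} V L" using marching_reachable[OF P reach] by auto
    have size: "heap_size H \<noteq> 0" using cond by (simp add: s)
    obtain x where x: "fmm_step P (V, L) (V', L')" "heap_of P V' L' H'" "c' \<le> c + 5 * (1 + b)"
      "x \<in> gridpts P - acc L" "acc L' = insert x (acc L)"
      by (rule heap_fmm_step_correct[OF P b inv H size s'])
    have "gridpts P - acc L = insert x (gridpts P - acc L')" "x \<notin> gridpts P - acc L'"
      using x(4,5) by auto
    then have card: "card (gridpts P - acc L) = Suc (card (gridpts P - acc L'))"
      using fin by simp
    have "c' + card (gridpts P - acc L') * (5 * (1 + b)) \<le> ?M * (7 + 6 * b)"
      using pot x(3) unfolding card mult_Suc by linarith
    moreover have "(fmm_step P)\<^sup>*\<^sup>* (fmm_init P) (V', L')"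
      using reach x(1) by (rule rtranclp.rtrancl_into_rtrancl)
    ultimately show ?thesis
      using x(2) card by (simp add: s s' I_def del: heap_fmm_step.simps)
  qed
  obtain t where t: "heap_fmm P xs = Some t"
    using measure_while_option_Some[of I _ "heap_fmm_step P" ?todo, OF step init]
    unfolding heap_fmm_def by blast
  obtain V L H c where t': "t = (V, L, H, c)" by (cases t)
  have "I t"
    using while_option_rule[of I, OF _ t[unfolded heap_fmm_def] init] step by blast
  \<comment> \<open>An empty heap means that no gridpoint is Considered, so the state is
    final.\<close>
  moreover have "heap_size H = 0"
    using while_option_stop[OF t[unfolded heap_fmm_def]] by (simp add: t')
  ultimately have "fmm_output P V" "c \<le> ?M * (7 + 6 * b)"
    by (auto simp: t' I_def fmm_output_def heap_of_def heap_items_def)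
  then show ?thesis using that t t' by blast
qed

section \<open>The bound in terms of the number of gridpoints\<close>

theorem mainTheorem4:
  "(\<forall>P V. valid_problem P \<longrightarrow> fmm_output P V \<longrightarrow> (\<forall>x\<in>gridpts P. upwind_eq P V x)) \<and>
   (\<exists>T :: nat \<Rightarrow> real. T \<in> O(\<lambda>M. real M * ln (real M)) \<and>
     (\<forall>P xs. valid_problem P \<longrightarrow> distinct xs \<longrightarrow> set xs = gridpts P \<longrightarrow>
       (\<exists>V L H c. heap_fmm P xs = Some (V, L, H, c) \<and> fmm_output P V \<and>
          real c \<le> T (card (gridpts P)))))"
\<comment> \<open>The witness is \<open>M * (7 + 6 * b)\<close> with \<open>b\<close> replaced by
  its bound \<open>1 + log 2 M\<close>.\<close>
proof (intro conjI exI[of _ "\<lambda>M. real M * (13 + 6 * log 2 (real M))"] allI impI ballI)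
  show "upwind_eq P V x" if "valid_problem P" "fmm_output P V" "x \<in> gridpts P" for P V x
    using that by (rule fmm_output_upwind_eq)
next
  \<comment> \<open>The comparison is asymptotic, so \<open>M = 1\<close>, where \<open>ln\<close>
    vanishes but the witness does not, is no obstacle.\<close>
  show "(\<lambda>M. real M * (13 + 6 * log 2 (real M))) \<in> O(\<lambda>M. real M * ln (real M))"
    unfolding log_def by real_asymp
next
  fix P and xs :: "gridpoint list"
  assume P: "valid_problem P" and xs: "distinct xs" "set xs = gridpts P"
  let ?M = "card (gridpts P)"
  \<comment> \<open>For a nonempty grid this is the largest \<open>k\<close> with
    \<open>2 ^ k \<le> 2 * ?M\<close>; for an empty grid no \<open>k\<close> satisfies this.\<close>
  define b where "b = nat \<lfloor>1 + log 2 (real ?M)\<rfloor>"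
  have b: "k \<le> b" if "2 ^ k \<le> 2 * ?M" for k
  proof -
    have "?M \<noteq> 0" using that by (metis mult_0_right not_le power_eq_0_iff neq0_conv zero_neq_numeral)
    have "real k = log 2 (2 ^ k)" by simp
    also have "\<dots> \<le> log 2 (2 * real ?M)"
      using that \<open>?M \<noteq> 0\<close> by (subst log_le_cancel_iff) (use of_nat_mono[OF that, where 'a = real] in auto)
    also have "\<dots> = 1 + log 2 (real ?M)" using \<open>?M \<noteq> 0\<close> by (simp add: log_mult)
    finally show ?thesis unfolding b_def by (rule le_nat_floor)
  qed
  obtain V L H c where res: "heap_fmm P xs = Some (V, L, H, c)" "fmm_output P V"
    and c: "c \<le> ?M * (7 + 6 * b)"
    using heap_fmm_correct[OF P b xs] by blast
  have "real c \<le> real (?M * (7 + 6 * b))" using c of_nat_le_iff by blast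
  also have "\<dots> \<le> real ?M * (13 + 6 * log 2 (real ?M))"
  \<comment> \<open>For \<open>?M = 0\<close> both sides vanish; otherwise the logarithm is
    nonnegative and \<open>nat\<close> cuts nothing off.\<close>
  proof (cases "?M = 0")
    case False
    then have "real b \<le> 1 + log 2 (real ?M)" by (simp add: b_def)
    then show ?thesis by (simp add: mult_left_mono)
  qed simp
  finally show "\<exists>V L H c. heap_fmm P xs = Some (V, L, H, c) \<and> fmm_output P V \<and>
      real c \<le> real ?M * (13 + 6 * log 2 (real ?M))"
    using res by blast
qed

end
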